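(* Let $\nu:\mathbb{R}^d\to\mathbb{R}_+$ be a normalization function, with unit "ball" $B_\nu=\{x\in\mathbb{R}^d:\nu(x)\le 1\}$ and associated Capra-coupling $c_\nu$. Let $f:\mathbb{R}^d\to\overline{\mathbb{R}}$ be a 0-homogeneous function. Then: 1. the function $f^{c_\nu\star'}$ is the tightest closed convex function below $f$ on $B_\nu$; 2. if $f(0)=0$, the function $\sigma_{\partial_{c_\nu}f(0)}$ (the support function of the Capra-subdifferential of $f$ at $0$) is the tightest closed convex positively 1-homogeneous function below $f$ on $B_\nu$.
   Context: $d$ is a positive integer, $\mathbb{R}^d$ has scalar product $\langle\cdot,\cdot\rangle$, and $\overline{\mathbb{R}}=[-\infty,+\infty]$. The Moreau lower addition, written $+_{\ell}$, extends the usual addition with $(+\infty)+_{\ell}(-\infty)=(-\infty)+_{\ell}(+\infty)=-\infty$. A function $f:\mathbb{R}^d\to\overline{\mathbb{R}}$ is 0-homogeneous if $f(\rho x)=f(x)$ for all $\rho\in\mathbb{R}\setminus\{0\}$, $x\in\mathbb{R}^d$; it is positively 1-homogeneous if $f(\rho x)=\rho f(x)$ for all real $\rho>0$, $x\in\mathbb{R}^d$. A function $\mathbb{R}^d\to\overline{\mathbb{R}}$ is convex if its epigraph $\{(x,t)\in\mathbb{R}^d\times\mathbb{R}: f(x)\le t\}$ is convex, lower semicontinuous (lsc) if its epigraph is closed, and closed if it is either lsc and nowhere equal to $-\infty$, or is the constant function $-\infty$. Thus the closed convex functions are the constants $-\infty$ and $+\infty$ together with all proper convex lsc functions. "The tightest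 function of a given class below $f$ on a set $W$" means the greatest element, for the pointwise order on functions $\mathbb{R}^d\to\overline{\mathbb{R}}$, of the set of functions $h:\mathbb{R}^d\to\overline{\mathbb{R}}$ in that class such that $h(x)\le f(x)$ for all $x\in W$. A normalization function is a function $\nu:\mathbb{R}^d\to\mathbb{R}_+$ that is absolutely 1-homogeneous ($\nu(\rho x)=|\rho|\nu(x)$ for all $\rho\in\mathbb{R}\setminus\{0\}$, $x\in\mathbb{R}^d$) and such that $\nu(x)=0$ if and only if $x=0$ (subadditivity is not required). The Capra-coupling associated with $\nu$ is $c_\nu:\mathbb{R}^d\times\mathbb{R}^d\to\mathbb{R}$, $c_\nu(x,y)=\langle x,y\rangle/\nu(x)$ if $x\ne 0$, and $c_\nu(0,y)=0$. The $c_\nu$-Fenchel-Moreau conjugate of $f$ is $f^{c_\nu}(y)=\sup_{x\in\mathbb{R}^d}\bigl(c_\nu(x,y)+_{\ell}(-f(x))\bigr)$, and $f^{c_\nu\star'}(x)=\sup_{y\in\mathbb{R}^d}\bigl(\langle x,y\rangle+_{\ell}(-f^{c_\nu}(y))\bigr)$. The Capra-subdifferential of $f$ at $x$ is $\partial_{c_\nu}f(x)=\{y\in\mathbb{R}^d: f^{c_\nu}(y)=c_\nu(x,y)+_{\ell}(-f(x))\}$. The support function of $Y\subset\mathbb{R}^d$ is $\sigma_Y(x)=\sup_{y\in Y}\langle x,y\rangle$ (so $\sigma_\emptyset=-\infty$). *)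

theory Defs
  imports "HOL-Analysis.Analysis"
begin

text \<open>Moreau lower addition. The library addition on \<^typ>\<open>ereal\<close> instead satisfies
  \<open>\<infinity> + (- \<infinity>) = \<infinity>\<close>.\<close>

definition lower_add :: "ereal \<Rightarrow> ereal \<Rightarrow> ereal"  (infixl \<open>+\<^sub>l\<close> 65) where
  "a +\<^sub>l b = (if a = - \<infinity> \<or> b = - \<infinity> then - \<infinity> else a + b)"

definition zero_homogeneous :: "('a::euclidean_space \<Rightarrow> ereal) \<Rightarrow> bool" where
  "zero_homogeneous f \<longleftrightarrow> (\<forall>\<rho>::real. \<forall>x. \<rho> \<noteq> 0 \<longrightarrow> f (\<rho> *\<^sub>R x) = f x)"

definition pos_one_homogeneous :: "('a::euclidean_space \<Rightarrow> ereal) \<Rightarrow> bool" where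
  "pos_one_homogeneous f \<longleftrightarrow> (\<forall>\<rho>::real. \<forall>x. \<rho> > 0 \<longrightarrow> f (\<rho> *\<^sub>R x) = ereal \<rho> * f x)"

text \<open>The library constant \<^const>\<open>epigraph\<close> only covers real-valued functions.\<close>

definition ereal_epigraph :: "('a::euclidean_space \<Rightarrow> ereal) \<Rightarrow> ('a \<times> real) set" where
  "ereal_epigraph f = {(x, t). f x \<le> ereal t}"

definition convex_fun :: "('a::euclidean_space \<Rightarrow> ereal) \<Rightarrow> bool" where
  "convex_fun f \<longleftrightarrow> convex (ereal_epigraph f)"

definition lsc_fun :: "('a::euclidean_space \<Rightarrow> ereal) \<Rightarrow> bool" where
  "lsc_fun f \<longleftrightarrow> closed (ereal_epigraph f)"

definition closed_fun :: "('a::euclidean_space \<Rightarrow> ereal) \<Rightarrow> bool" where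
  "closed_fun f \<longleftrightarrow> (lsc_fun f \<and> (\<forall>x. f x \<noteq> - \<infinity>)) \<or> f = (\<lambda>x. - \<infinity>)"

definition tightest_below ::
    "(('a::euclidean_space \<Rightarrow> ereal) \<Rightarrow> bool) \<Rightarrow> ('a \<Rightarrow> ereal) \<Rightarrow> 'a set \<Rightarrow> ('a \<Rightarrow> ereal) \<Rightarrow> bool" where
  "tightest_below C f W g \<longleftrightarrow>
     (C g \<and> (\<forall>x\<in>W. g x \<le> f x)) \<and>
     (\<forall>h. C h \<and> (\<forall>x\<in>W. h x \<le> f x) \<longrightarrow> (\<forall>x. h x \<le> g x))"

definition normalization_function :: "('a::euclidean_space \<Rightarrow> real) \<Rightarrow> bool" where
  "normalization_function \<nu> \<longleftrightarrow>
     (\<forall>x. 0 \<le> \<nu> x) \<and>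
     (\<forall>\<rho>::real. \<forall>x. \<rho> \<noteq> 0 \<longrightarrow> \<nu> (\<rho> *\<^sub>R x) = \<bar>\<rho>\<bar> * \<nu> x) \<and>
     (\<forall>x. \<nu> x = 0 \<longleftrightarrow> x = 0)"

definition normalization_ball :: "('a::euclidean_space \<Rightarrow> real) \<Rightarrow> 'a set" where
  "normalization_ball \<nu> = {x. \<nu> x \<le> 1}"

definition capra_coupling :: "('a::euclidean_space \<Rightarrow> real) \<Rightarrow> 'a \<Rightarrow> 'a \<Rightarrow> real" where
  "capra_coupling \<nu> x y = (if x = 0 then 0 else (x \<bullet> y) / \<nu> x)"

definition capra_conjugate ::
    "('a::euclidean_space \<Rightarrow> real) \<Rightarrow> ('a \<Rightarrow> ereal) \<Rightarrow> 'a \<Rightarrow> ereal" where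
  "capra_conjugate \<nu> f y = (SUP x. ereal (capra_coupling \<nu> x y) +\<^sub>l (- f x))"

text \<open>The second conjugation uses the ordinary scalar product (Fenchel) coupling,
  not the Capra coupling.\<close>

definition capra_star_biconjugate ::
    "('a::euclidean_space \<Rightarrow> real) \<Rightarrow> ('a \<Rightarrow> ereal) \<Rightarrow> 'a \<Rightarrow> ereal" where
  "capra_star_biconjugate \<nu> f x = (SUP y. ereal (x \<bullet> y) +\<^sub>l (- capra_conjugate \<nu> f y))"

definition capra_subdifferential ::
    "('a::euclidean_space \<Rightarrow> real) \<Rightarrow> ('a \<Rightarrow> ereal) \<Rightarrow> 'a \<Rightarrow> 'a set" where
  "capra_subdifferential \<nu> f x =
     {y. capra_conjugate \<nu> f y = ereal (capra_coupling \<nu> x y) +\<^sub>l (- f x)}"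

definition support_function :: "'a::euclidean_space set \<Rightarrow> 'a \<Rightarrow> ereal" where
  "support_function Y x = (SUP y\<in>Y. ereal (x \<bullet> y))"

end

theory Submission imports Defs
begin

text \<open>Since \<open>f\<close> is 0-homogeneous and \<open>\<nu>\<close> is even, normalizing a point of the ball can only
  increase \<open>\<bar>\<langle>x, y\<rangle>\<bar>\<close> and leaves \<open>f\<close> unchanged. So \<open>f\<^sup>c(y) \<le> b\<close> holds iff the affine function
  \<open>\<langle>\<cdot>, y\<rangle> - b\<close> is below \<open>f\<close> on the ball, and both parts follow because a closed convex function
  is the supremum of its affine minorants (of its linear minorants, if it is positively
  1-homogeneous and not \<open>+\<infinity>\<close> at the origin).\<close>

section \<open>Affine minorants of closed convex functions by separation of the epigraph\<close>

lemma affine_minorant_of_separation: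
  fixes h :: "'a::euclidean_space \<Rightarrow> ereal"
  assumes "\<And>x. h x \<noteq> - \<infinity>" and "c > 0"
    and sep: "\<And>x t. h x \<le> ereal t \<Longrightarrow> \<beta> < a \<bullet> x + c * t"
  shows "ereal (x \<bullet> (- a /\<^sub>R c) - (- \<beta> / c)) \<le> h x"
proof (cases "h x")
  case (real r)
  then have "\<beta> < a \<bullet> x + c * r" using sep by simp
  then have "(\<beta> - a \<bullet> x) / c \<le> r"
    using \<open>c > 0\<close> by (simp add: field_simps)
  then show ?thesis
    using real by (simp add: inner_commute divide_inverse algebra_simps)
qed (use assms in auto)

lemma epigraph_separation:
  fixes h :: "'a::euclidean_space \<Rightarrow> ereal"
  assumes "lsc_fun h" "convex_fun h" and "ereal t0 < h x0"
  obtains a c \<beta> where "a \<bullet> x0 + c * t0 < \<beta>"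
    and "\<And>x t. h x \<le> ereal t \<Longrightarrow> \<beta> < a \<bullet> x + c * t"
proof -
  have "(x0, t0) \<notin> ereal_epigraph h"
    using assms(3) by (simp add: ereal_epigraph_def)
  then obtain p \<beta> where "p \<bullet> (x0, t0) < \<beta>" "\<forall>z\<in>ereal_epigraph h. \<beta> < p \<bullet> z"
    using separating_hyperplane_closed_point[of "ereal_epigraph h" "(x0, t0)"] assms(1,2)
    unfolding lsc_fun_def convex_fun_def by blast
  then show thesis
    by (cases p) (auto simp: ereal_epigraph_def intro!: that[of "fst p" "snd p" \<beta>])
qed

text \<open>The separated point \<open>(x1, r - 1)\<close> lies straight below the graph point
  \<open>(x1, r)\<close>, so the hyperplane between them cannot be vertical and is the graph of an
  affine function.\<close>

lemma affine_minorant_at_finite: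
  fixes h :: "'a::euclidean_space \<Rightarrow> ereal"
  assumes "lsc_fun h" "convex_fun h" and fin: "\<And>x. h x \<noteq> - \<infinity>" and "h x1 = ereal r"
  obtains y b where "\<And>x. ereal (x \<bullet> y - b) \<le> h x"
proof -
  obtain a c \<beta> where *: "a \<bullet> x1 + c * (r - 1) < \<beta>"
    and sep: "\<And>x t. h x \<le> ereal t \<Longrightarrow> \<beta> < a \<bullet> x + c * t"
    using epigraph_separation[of h "r - 1" x1] assms by auto
  have "\<beta> < a \<bullet> x1 + c * r" using sep assms(4) by simp
  with * have "c > 0" by (simp add: algebra_simps)
  then show thesis using that affine_minorant_of_separation[of h c \<beta> a] fin sep by blast
qed

lemma affine_minorant_above:
  fixes h :: "'a::euclidean_space \<Rightarrow> ereal"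
  assumes "lsc_fun h" "convex_fun h" and fin: "\<And>x. h x \<noteq> - \<infinity>" and "ereal t0 < h x0"
  obtains y b where "\<And>x. ereal (x \<bullet> y - b) \<le> h x" and "t0 < x0 \<bullet> y - b"
proof (cases "\<forall>x. h x = \<infinity>")
  case True
  \<comment> \<open>The constant function \<open>t0 + 1\<close> serves as the minorant.\<close>
  then show thesis using that[of 0 "- t0 - 1"] by simp
next
  case False
  then obtain x1 r where r: "h x1 = ereal r"
    by (metis fin ereal_cases)
  obtain a c \<beta> where x0: "a \<bullet> x0 + c * t0 < \<beta>"
    and sep: "\<And>x t. h x \<le> ereal t \<Longrightarrow> \<beta> < a \<bullet> x + c * t"
    using epigraph_separation assms(1,2,4) by blast
  have "c \<ge> 0"
  proof (rule ccontr)
    assume "\<not> c \<ge> 0"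
    then have "c < 0" by simp
    \<comment> \<open>The first bound keeps \<open>(x1, t)\<close> in the epigraph; by the second,
      as \<open>c\<close> is negative, \<open>a \<bullet> x1 + c * t\<close> is at most
      \<open>\<beta>\<close>.\<close>
    define t where "t = max r ((\<beta> - a \<bullet> x1) / c)"
    have "\<beta> < a \<bullet> x1 + c * t" using sep r by (simp add: t_def)
    moreover have "c * t \<le> c * ((\<beta> - a \<bullet> x1) / c)"
      using \<open>c < 0\<close> by (intro mult_left_mono_neg) (auto simp: t_def)
    ultimately show False using \<open>c < 0\<close> by simp
  qed
  show thesis
  proof (cases "c = 0")
    case False
    with \<open>c \<ge> 0\<close> have "c > 0" by simp
    then have "t0 < x0 \<bullet> (- a /\<^sub>R c) - (- \<beta> / c)"
      using x0 by (simp add: inner_commute field_simps)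
    then show thesis
      using that affine_minorant_of_separation[of h c \<beta> a] fin sep \<open>c > 0\<close> by blast
  next
    case True
    \<comment> \<open>The hyperplane is vertical: tilt some affine minorant by a large multiple of
      \<open>\<beta> - \<langle>a, \<cdot>\<rangle>\<close>, which is positive at \<open>x0\<close> and negative where \<open>h\<close> is finite.\<close>
    obtain y b where min: "\<And>x. ereal (x \<bullet> y - b) \<le> h x"
      using affine_minorant_at_finite[of h x1 r] assms r by blast
    define \<delta> where "\<delta> = \<beta> - a \<bullet> x0"
    have "\<delta> > 0" using x0 True by (simp add: \<delta>_def)
    \<comment> \<open>The tilt raises the minorant at \<open>x0\<close> by
      \<open>k * \<delta>\<close>, chosen as one more than its distance from
      \<open>t0\<close>.\<close>
    define k where "k = (\<bar>t0 - (x0 \<bullet> y - b)\<bar> + 1) / \<delta>"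
    have "k \<ge> 0" using \<open>\<delta> > 0\<close> by (simp add: k_def)
    have k: "k * \<delta> = \<bar>t0 - (x0 \<bullet> y - b)\<bar> + 1" using \<open>\<delta> > 0\<close> by (simp add: k_def)
    show thesis
    proof (rule that[of "y - k *\<^sub>R a" "b - k * \<beta>"])
      fix x
      show "ereal (x \<bullet> (y - k *\<^sub>R a) - (b - k * \<beta>)) \<le> h x"
      proof (cases "h x")
        case (real s)
        then have "k * (\<beta> - a \<bullet> x) \<le> 0"
          using sep[of x s] True \<open>k \<ge> 0\<close> by (simp add: mult_nonneg_nonpos)
        moreover have "x \<bullet> y - b \<le> s" using min[of x] real by simp
        ultimately show ?thesis
          using real by (simp add: inner_diff_right inner_commute algebra_simps)
      qed (use fin in auto)
    next
      have "t0 < x0 \<bullet> y - b + k * \<delta>" using k by linarith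
      then show "t0 < x0 \<bullet> (y - k *\<^sub>R a) - (b - k * \<beta>)"
        by (simp add: \<delta>_def inner_diff_right inner_commute algebra_simps)
    qed
  qed
qed

text \<open>Otherwise some affine minorant would exceed, at \<open>x\<close>, a real level between
  \<open>s\<close> and \<open>h x\<close>. Both maximality proofs use the supremum representation in
  this form; the constant \<open>- \<infinity>\<close>, which has no affine minorant, is
  trivial.\<close>

lemma closed_convex_le_if_affine_minorants_le:
  fixes h :: "'a::euclidean_space \<Rightarrow> ereal"
  assumes "closed_fun h" "convex_fun h"
    and affine_le: "\<And>y b. (\<And>z. ereal (z \<bullet> y - b) \<le> h z) \<Longrightarrow> ereal (x \<bullet> y - b) \<le> s"
  shows "h x \<le> s"
proof (cases "h = (\<lambda>x. - \<infinity>)")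
  case False
  then have h: "lsc_fun h" "\<And>x. h x \<noteq> - \<infinity>"
    using assms(1) by (auto simp: closed_fun_def)
  show ?thesis
  proof (rule ccontr)
    assume "\<not> h x \<le> s"
    then obtain t where t: "s < ereal t" "ereal t < h x"
      using ereal_dense2 by (metis not_le)
    then obtain y b where "\<And>z. ereal (z \<bullet> y - b) \<le> h z" "t < x \<bullet> y - b"
      using affine_minorant_above[OF h(1) assms(2) h(2)] by blast
    then have "ereal t < s"
      using affine_le[of y b] by (meson ereal_less_eq(3) less_ereal.simps(1) less_le_trans)
    then show False using t by simp
  qed
qed simp

section \<open>Suprema of affine functions\<close>

lemma closed_convex_SUP_affine:
  fixes Y :: "'i \<Rightarrow> 'a::euclidean_space"
  shows "closed_fun (\<lambda>x. SUP i\<in>I. ereal (x \<bullet> Y i) +\<^sub>l a i)" (is "closed_fun ?g")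
    and "convex_fun (\<lambda>x. SUP i\<in>I. ereal (x \<bullet> Y i) +\<^sub>l a i)"
proof -
  \<comment> \<open>Each set in the intersection is a half-space if \<open>a i\<close> is real,
    empty if it is \<open>\<infinity>\<close>, and the whole space if it is
    \<open>- \<infinity>\<close>.\<close>
  have epi: "ereal_epigraph ?g = (\<Inter>i\<in>I. ereal_epigraph (\<lambda>x. ereal (x \<bullet> Y i) +\<^sub>l a i))"
    by (auto simp: ereal_epigraph_def SUP_le_iff)
  have "closed (ereal_epigraph (\<lambda>x. ereal (x \<bullet> Y i) +\<^sub>l a i)) \<and>
        convex (ereal_epigraph (\<lambda>x. ereal (x \<bullet> Y i) +\<^sub>l a i))" for i
  proof (cases "a i")
    case (real r)
    then have "ereal_epigraph (\<lambda>x. ereal (x \<bullet> Y i) +\<^sub>l a i) = {z. (Y i, - 1) \<bullet> z \<le> - r}"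
      by (auto simp: ereal_epigraph_def lower_add_def inner_commute algebra_simps)
    then show ?thesis by (simp add: closed_halfspace_le convex_halfspace_le)
  qed (simp_all add: ereal_epigraph_def lower_add_def)
  then have "lsc_fun ?g" "convex_fun ?g"
    unfolding lsc_fun_def convex_fun_def epi by (auto intro!: closed_INT convex_INT)
  moreover have "closed_fun ?g" if "lsc_fun ?g"
  \<comment> \<open>This case includes empty \<open>I\<close>. In the other case, a single index
    keeps the supremum above \<open>- \<infinity>\<close> everywhere.\<close>
  proof (cases "\<forall>i\<in>I. a i = - \<infinity>")
    case True
    then have "?g = (\<lambda>x. - \<infinity>)"
      by (intro ext antisym SUP_least) (auto simp: lower_add_def)
    then show ?thesis by (simp add: closed_fun_def)
  next
    case False
    then obtain i where "i \<in> I" "a i \<noteq> - \<infinity>" by blast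
    have "?g x \<noteq> - \<infinity>" for x
    proof -
      have "- \<infinity> < ereal (x \<bullet> Y i) +\<^sub>l a i"
        using \<open>a i \<noteq> - \<infinity>\<close> by (cases "a i") (simp_all add: lower_add_def)
      also have "\<dots> \<le> ?g x"
        using \<open>i \<in> I\<close> by (rule SUP_upper)
      finally show ?thesis by simp
    qed
    with that show ?thesis by (simp add: closed_fun_def)
  qed
  ultimately show "closed_fun ?g" "convex_fun ?g" by blast+
qed

section \<open>The Capra conjugate and affine functions below \<open>f\<close> on the ball\<close>

lemma zero_in_normalization_ball:
  assumes "normalization_function \<nu>"
  shows "0 \<in> normalization_ball \<nu>"
proof -
  have "\<nu> 0 = 0" using assms by (auto simp: normalization_function_def)
  then show ?thesis by (simp add: normalization_ball_def)
qed

lemma capra_conjugate_le_iff: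
  assumes \<nu>: "normalization_function \<nu>" and f: "zero_homogeneous f"
  shows "capra_conjugate \<nu> f y \<le> ereal b \<longleftrightarrow>
    (\<forall>x\<in>normalization_ball \<nu>. ereal (x \<bullet> y - b) \<le> f x)"
proof -
  \<comment> \<open>With \<open>r\<close> and \<open>b\<close> real, lower addition keeps this valid
    at infinite \<open>f x\<close>: both sides hold for \<open>\<infinity>\<close> and fail for
    \<open>- \<infinity>\<close>.\<close>
  have term_le: "ereal r +\<^sub>l (- f x) \<le> ereal b \<longleftrightarrow> ereal (r - b) \<le> f x" for r x
    by (cases "f x") (auto simp: lower_add_def)
  have pos: "\<nu> x > 0" if "x \<noteq> 0" for x
    using \<nu> that unfolding normalization_function_def by (metis less_eq_real_def)
  have "(\<forall>x. ereal (capra_coupling \<nu> x y - b) \<le> f x) \<longleftrightarrow>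
    (\<forall>x\<in>normalization_ball \<nu>. ereal (x \<bullet> y - b) \<le> f x)" (is "?L \<longleftrightarrow> ?R")
  proof
    assume L: ?L
    show ?R
    proof
      fix x assume "x \<in> normalization_ball \<nu>"
      then have le1: "\<nu> x \<le> 1" by (simp add: normalization_ball_def)
      show "ereal (x \<bullet> y - b) \<le> f x"
      proof (cases "x = 0")
        case True
        then show ?thesis using L[rule_format, of 0] by (simp add: capra_coupling_def)
      next
        case False
        \<comment> \<open>Dividing a negative \<open>x \<bullet> y\<close> by \<open>\<nu> x\<close>
          may lower it, so the bound at \<open>x\<close> alone is too weak; the one at
          \<open>- x\<close> brings in the absolute value.\<close>
        have "\<nu> (- 1 *\<^sub>R x) = \<bar>- 1\<bar> * \<nu> x" "f (- 1 *\<^sub>R x) = f x"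
          using \<nu> f unfolding normalization_function_def zero_homogeneous_def
          by (metis zero_neq_neg_one)+
        then have "ereal (x \<bullet> y / \<nu> x - b) \<le> f x" "ereal (- (x \<bullet> y) / \<nu> x - b) \<le> f x"
          using L[rule_format, of x] L[rule_format, of "- x"] False
          by (simp_all add: capra_coupling_def)
        then have "ereal (\<bar>x \<bullet> y\<bar> / \<nu> x - b) \<le> f x" by (auto simp: abs_if)
        moreover have "x \<bullet> y \<le> \<bar>x \<bullet> y\<bar> / \<nu> x"
        proof -
          have "\<bar>x \<bullet> y\<bar> * \<nu> x \<le> \<bar>x \<bullet> y\<bar>"
            using le1 by (simp add: mult_left_le)
          then have "\<bar>x \<bullet> y\<bar> \<le> \<bar>x \<bullet> y\<bar> / \<nu> x"
            using pos[OF False] by (simp add: le_divide_eq)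
          then show ?thesis by linarith
        qed
        ultimately show ?thesis
          by (meson diff_right_mono ereal_less_eq(3) order_trans)
      qed
    qed
  next
    assume R: ?R
    show ?L
    proof
      fix x
      show "ereal (capra_coupling \<nu> x y - b) \<le> f x"
      proof (cases "x = 0")
        case True
        then show ?thesis
          using bspec[OF R zero_in_normalization_ball[OF \<nu>]] by (simp add: capra_coupling_def)
      next
        case False
        \<comment> \<open>On the unit sphere of \<open>\<nu>\<close> the coupling is the scalar
          product.\<close>
        define u where "u = inverse (\<nu> x) *\<^sub>R x"
        have nz: "inverse (\<nu> x) \<noteq> 0" using pos[OF False] by simp
        have "\<nu> u = \<bar>inverse (\<nu> x)\<bar> * \<nu> x" "f u = f x"
          unfolding u_def using \<nu> f nz unfolding normalization_function_def zero_homogeneous_def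
          by blast+
        then have "u \<in> normalization_ball \<nu>"
          using pos[OF False] by (simp add: normalization_ball_def)
        then have "ereal (u \<bullet> y - b) \<le> f x"
          using R \<open>f u = f x\<close> by metis
        then show ?thesis using False by (simp add: u_def capra_coupling_def divide_inverse mult.commute)
      qed
    qed
  qed
  then show ?thesis
    by (simp add: capra_conjugate_def SUP_le_iff term_le)
qed

lemma capra_star_biconjugate_le:
  assumes "normalization_function \<nu>" and "zero_homogeneous f" and "x \<in> normalization_ball \<nu>"
  shows "capra_star_biconjugate \<nu> f x \<le> f x"
  unfolding capra_star_biconjugate_def
proof (rule SUP_least)
  fix y
  have le: "ereal (x \<bullet> y - b) \<le> f x" if "capra_conjugate \<nu> f y \<le> ereal b" for b
    using capra_conjugate_le_iff[OF assms(1,2)] that assms(3) by blast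
  show "ereal (x \<bullet> y) +\<^sub>l - capra_conjugate \<nu> f y \<le> f x"
  proof (cases "capra_conjugate \<nu> f y")
    case (real r)
    then show ?thesis using le[of r] by (simp add: lower_add_def)
  next
    case MInf
    \<comment> \<open>Every real bounds the conjugate here, so the offset can be picked to give the
      affine function any value \<open>t\<close> at \<open>x\<close>.\<close>
    have "ereal t \<le> f x" for t
      using le[of "x \<bullet> y - t"] MInf by simp
    then have "f x = \<infinity>" using ereal_top by blast
    then show ?thesis by simp
  qed (simp add: lower_add_def)
qed

lemma affine_le_capra_star_biconjugate:
  assumes "capra_conjugate \<nu> f y \<le> ereal b"
  shows "ereal (x \<bullet> y - b) \<le> capra_star_biconjugate \<nu> f x"
proof -
  have "ereal (x \<bullet> y - b) \<le> ereal (x \<bullet> y) +\<^sub>l - capra_conjugate \<nu> f y"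
    using assms by (cases "capra_conjugate \<nu> f y") (auto simp: lower_add_def)
  also have "\<dots> \<le> capra_star_biconjugate \<nu> f x"
    unfolding capra_star_biconjugate_def by (rule SUP_upper) simp
  finally show ?thesis .
qed

text \<open>For maximality, an affine minorant of a competitor is below \<open>f\<close> on the
  ball, so its offset bounds the conjugate and the minorant is below the biconjugate.\<close>

lemma tightest_closed_convex_below_ball:
  assumes "normalization_function \<nu>" and "zero_homogeneous f"
  shows "tightest_below (\<lambda>h. closed_fun h \<and> convex_fun h)
    f (normalization_ball \<nu>) (capra_star_biconjugate \<nu> f)"
proof -
  have "h x \<le> capra_star_biconjugate \<nu> f x"
    if h: "closed_fun h" "convex_fun h" and le: "\<forall>x\<in>normalization_ball \<nu>. h x \<le> f x" for h x
  proof (rule closed_convex_le_if_affine_minorants_le[OF h])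
    fix y b assume "\<And>z. ereal (z \<bullet> y - b) \<le> h z"
    then have "capra_conjugate \<nu> f y \<le> ereal b"
      using le capra_conjugate_le_iff[OF assms] order_trans by blast
    then show "ereal (x \<bullet> y - b) \<le> capra_star_biconjugate \<nu> f x"
      by (rule affine_le_capra_star_biconjugate)
  qed
  moreover have "closed_fun (capra_star_biconjugate \<nu> f)" "convex_fun (capra_star_biconjugate \<nu> f)"
    unfolding capra_star_biconjugate_def[abs_def] by (rule closed_convex_SUP_affine)+
  ultimately show ?thesis
    unfolding tightest_below_def using capra_star_biconjugate_le[OF assms] by blast
qed

section \<open>The subdifferential at the origin and positive homogeneity\<close>

lemma capra_subdifferential_zero_iff:
  assumes "normalization_function \<nu>" and "zero_homogeneous f" and "f 0 = 0"
  shows "y \<in> capra_subdifferential \<nu> f 0 \<longleftrightarrow>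
    (\<forall>x\<in>normalization_ball \<nu>. ereal (x \<bullet> y) \<le> f x)"
proof -
  \<comment> \<open>The origin contributes 0 to the supremum, so the equality defining the
    subdifferential reduces to the upper bound 0 on the conjugate.\<close>
  have "ereal (capra_coupling \<nu> 0 y) +\<^sub>l - f 0 \<le> capra_conjugate \<nu> f y"
    unfolding capra_conjugate_def by (rule SUP_upper) simp
  then have "0 \<le> capra_conjugate \<nu> f y"
    using assms(3) by (simp add: capra_coupling_def lower_add_def zero_ereal_def)
  moreover have "y \<in> capra_subdifferential \<nu> f 0 \<longleftrightarrow> capra_conjugate \<nu> f y = 0"
    using assms(3)
    by (simp add: capra_subdifferential_def capra_coupling_def lower_add_def zero_ereal_def)
  ultimately have "y \<in> capra_subdifferential \<nu> f 0 \<longleftrightarrow> capra_conjugate \<nu> f y \<le> ereal 0"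
    by (metis antisym order_refl zero_ereal_def)
  then show ?thesis using capra_conjugate_le_iff[OF assms(1,2), of y 0] by simp
qed

text \<open>Evaluating the minorant at \<open>\<rho> *\<^sub>R x\<close> and dividing by a large
  \<open>\<rho>\<close> makes the offset negligible.\<close>

lemma linear_minorant_of_pos_one_homogeneous:
  fixes h :: "'a::euclidean_space \<Rightarrow> ereal"
  assumes "pos_one_homogeneous h" and minor: "\<And>z. ereal (z \<bullet> y - b) \<le> h z"
  shows "ereal (x \<bullet> y) \<le> h x"
proof (cases "h x")
  case (real r)
  have "\<rho> * (x \<bullet> y - r) \<le> b" if "\<rho> > 0" for \<rho>
    using minor[of "\<rho> *\<^sub>R x"] assms(1) that real
    by (simp add: pos_one_homogeneous_def algebra_simps)
  note scaled = this
  have "x \<bullet> y \<le> r"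
  proof (rule ccontr)
    assume "\<not> x \<bullet> y \<le> r"
    then have "x \<bullet> y - r > 0" by simp
    then show False
      \<comment> \<open>With this factor \<open>scaled\<close> reads
        \<open>\<bar>b\<bar> + 1 \<le> b\<close>.\<close>
      using scaled[of "(\<bar>b\<bar> + 1) / (x \<bullet> y - r)"] by simp
  qed
  then show ?thesis using real by simp
qed (use minor[of x] in auto)

lemma pos_one_homogeneous_support_function: "pos_one_homogeneous (support_function Y)"
  unfolding pos_one_homogeneous_def
proof (intro allI impI)
  fix \<rho> :: real and x :: 'a
  assume "\<rho> > 0"
  show "support_function Y (\<rho> *\<^sub>R x) = ereal \<rho> * support_function Y x"
  proof (cases "Y = {}")
    case True
    then show ?thesis
      using \<open>\<rho> > 0\<close> by (simp add: support_function_def bot_ereal_def)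
  next
    case False
    then show ?thesis
      using \<open>\<rho> > 0\<close> by (simp add: support_function_def Sup_ereal_mult_left')
  qed
qed

lemma tightest_closed_convex_homogeneous_below_ball:
  assumes "normalization_function \<nu>" and "zero_homogeneous f" and "f 0 = 0"
  shows "tightest_below (\<lambda>h. closed_fun h \<and> convex_fun h \<and> pos_one_homogeneous h)
    f (normalization_ball \<nu>) (support_function (capra_subdifferential \<nu> f 0))"
proof -
  let ?D = "capra_subdifferential \<nu> f 0"
  have "h x \<le> support_function ?D x"
    if h: "closed_fun h" "convex_fun h" and hom: "pos_one_homogeneous h"
      and le: "\<forall>x\<in>normalization_ball \<nu>. h x \<le> f x" for h x
  proof (rule closed_convex_le_if_affine_minorants_le[OF h])
    fix y b assume minor: "\<And>z. ereal (z \<bullet> y - b) \<le> h z"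
    have "y \<in> ?D"
      using linear_minorant_of_pos_one_homogeneous[OF hom minor] le order_trans
      unfolding capra_subdifferential_zero_iff[OF assms] by blast
    then have "ereal (x \<bullet> y) \<le> support_function ?D x"
      unfolding support_function_def by (rule SUP_upper)
    \<comment> \<open>At the origin the minorant is at most \<open>f 0 = 0\<close>, so dropping the
      offset only increases it.\<close>
    moreover have "ereal (- b) \<le> 0"
      using minor[of 0] bspec[OF le zero_in_normalization_ball[OF assms(1)]] assms(3)
      by (metis diff_0 inner_zero_left order_trans)
    then have "ereal (x \<bullet> y - b) \<le> ereal (x \<bullet> y)" by simp
    ultimately show "ereal (x \<bullet> y - b) \<le> support_function ?D x" by (rule order_trans[rotated])
  qed
  \<comment> \<open>Zero offsets put the support function in the form of a supremum of affine
    functions; an empty \<open>?D\<close> gives the constant \<open>- \<infinity>\<close>.\<close>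
  moreover have "support_function ?D = (\<lambda>x. SUP y\<in>?D. ereal (x \<bullet> y) +\<^sub>l 0)"
    by (simp add: support_function_def[abs_def] lower_add_def)
  then have "closed_fun (support_function ?D)" "convex_fun (support_function ?D)"
    using closed_convex_SUP_affine[where Y = "\<lambda>y. y" and I = ?D and a = "\<lambda>_. 0"] by simp_all
  moreover have "support_function ?D x \<le> f x" if "x \<in> normalization_ball \<nu>" for x
    unfolding support_function_def using capra_subdifferential_zero_iff[OF assms] that
    by (blast intro: SUP_least)
  ultimately show ?thesis
    unfolding tightest_below_def using pos_one_homogeneous_support_function by blast
qed

theorem theorem8:
  fixes \<nu> :: "real ^ 'n \<Rightarrow> real"
    and f :: "real ^ 'n \<Rightarrow> ereal"
  assumes "normalization_function \<nu>"
    and "zero_homogeneous f"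
  shows "tightest_below (\<lambda>h. closed_fun h \<and> convex_fun h)
           f (normalization_ball \<nu>) (capra_star_biconjugate \<nu> f) \<and>
         (f 0 = 0 \<longrightarrow>
           tightest_below (\<lambda>h. closed_fun h \<and> convex_fun h \<and> pos_one_homogeneous h)
             f (normalization_ball \<nu>) (support_function (capra_subdifferential \<nu> f 0)))"
  using tightest_closed_convex_below_ball tightest_closed_convex_homogeneous_below_ball assms
  by blast

end
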